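(* Let $G$ be a bipartite graph with nonempty bipartition $(A,B)$ and let $n = |A| + |B|$. Then $$\partial(G) + \partial(\bar{G}) \leq 2(2^{\lfloor n/2 \rfloor} - 1)(2^{\lceil n/2 \rceil} - 1) + 2.$$
   Context: Graphs are finite and simple (undirected, no loops or multiple edges), and $\bar{G}$ denotes the complement of $G$ (on the same vertex set). A subset $S \subseteq V(G)$ is dominating in $G$ if every vertex of $G$ is either in $S$ or adjacent in $G$ to a vertex of $S$. $\partial(G)$ denotes the number of dominating sets of $G$. A graph $G$ is bipartite with nonempty bipartition $(A,B)$ if $V(G)$ is the disjoint union of the nonempty sets $A$ and $B$ and $G$ has no edge with both endpoints in $A$ and no edge with both endpoints in $B$. *)

theory Defs
  imports "Graph_Theory.Pair_Digraph"
begin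

text \<open>
  Finite simple graphs are the \<^locale>\<open>pair_graph\<close>s of the library: finite vertex set and a
  symmetric, irreflexive relation \<^const>\<open>parcs\<close> on it. An undirected edge \<open>uv\<close> is
  represented by both \<open>(u, v)\<close> and \<open>(v, u)\<close>. The null graph is allowed.
\<close>

definition complement :: "'a pair_pre_digraph \<Rightarrow> 'a pair_pre_digraph" where
  "complement G =
    \<lparr>pverts = pverts G,
     parcs = {(u, v). u \<in> pverts G \<and> v \<in> pverts G \<and> u \<noteq> v \<and> (u, v) \<notin> parcs G}\<rparr>"

definition dominating :: "'a pair_pre_digraph \<Rightarrow> 'a set \<Rightarrow> bool" where
  "dominating G S \<longleftrightarrow>
    S \<subseteq> pverts G \<and> (\<forall>v \<in> pverts G. v \<in> S \<or> (\<exists>u \<in> S. (v, u) \<in> parcs G))"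

definition num_dominating :: "'a pair_pre_digraph \<Rightarrow> nat" where
  "num_dominating G = card {S. dominating G S}"

definition nonempty_bipartition :: "'a pair_pre_digraph \<Rightarrow> 'a set \<Rightarrow> 'a set \<Rightarrow> bool" where
  "nonempty_bipartition G A B \<longleftrightarrow>
    A \<noteq> {} \<and> B \<noteq> {} \<and> A \<inter> B = {} \<and> A \<union> B = pverts G \<and>
    (\<forall>u \<in> A. \<forall>v \<in> A. (u, v) \<notin> parcs G) \<and>
    (\<forall>u \<in> B. \<forall>v \<in> B. (u, v) \<notin> parcs G)"

lemma pair_graph_complement:
  assumes "pair_graph G"
  shows "pair_graph (complement G)"
proof -
  interpret pair_graph G by fact
  have "parcs (complement G) \<subseteq> pverts G \<times> pverts G"
    by (auto simp: complement_def)
  then have "finite (parcs (complement G))"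
    by (rule finite_subset) (simp add: pair_finite_verts)
  then show ?thesis
    by unfold_locales
      (auto simp: complement_def pair_finite_verts symmetric_def sym_def dest: arcs_symmetric)
qed

lemma finite_dominating:
  assumes "pair_graph G"
  shows "finite {S. dominating G S}"
proof -
  interpret pair_graph G by fact
  have "{S. dominating G S} \<subseteq> Pow (pverts G)"
    by (auto simp: dominating_def)
  then show ?thesis
    by (rule finite_subset) (simp add: pair_finite_verts)
qed

end

theory Submission
  imports Defs
begin

text \<open>
  Call a vertex set \<^emph>\<open>straddling\<close> if it meets both sides. In the complement each side is a
  clique, so every straddling set dominates the complement, whereas in \<open>G\<close> a dominating set that
  is not straddling must be all of \<open>A\<close> or all of \<open>B\<close>. The complete bipartite graph is dominated by
  all straddling sets, by \<open>A\<close> and by \<open>B\<close>, and its complement only by the straddling sets, so there the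
  sum is \<open>2 (2\<^sup>a - 1) (2\<^sup>b - 1) + 2\<close> with \<open>a = |A|\<close> and \<open>b = |B|\<close>. When edges are missing, the
  complement may gain dominating sets, namely the subsets of one side that meet the set of
  non-neighbours of every vertex of the other side (here called hitting), and the point is that \<open>G\<close>
  loses at least as many: \<open>card_hitting_le_undominating\<close>.

  The comparison takes a fixed \<open>w\<close> in \<open>B\<close> and sends \<open>S \<subseteq> A\<close> to \<open>(A - S) \<union> {w}\<close>. If \<open>S\<close> contains a
  non-neighbour \<open>v\<close> of \<open>w\<close>, then \<open>v\<close> is not dominated by the image in \<open>G\<close>. This injection fails to
  give a straddling set only for \<open>S = A\<close>, and that loss of one is compensated as soon as two
  vertices of \<open>B\<close> have different neighbourhoods, provided \<open>w\<close> is chosen well. The same is done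
  with the sides exchanged. The two families of losses share at most the two-element set made of
  the two chosen vertices, and if they do share it, another lost two-element set can be exhibited.
  If instead all vertices of one side have the same neighbourhood, \<open>G\<close> is a complete bipartite
  graph together with isolated vertices. If it has an edge, then only one side can have hitting
  subsets, and the one set still needed is the other side, which no longer dominates \<open>G\<close>; if it has
  none, everything can be counted.

  Finally \<open>(2\<^sup>a - 1) (2\<^sup>b - 1)\<close> with \<open>a + b = n\<close> is largest when the two sides are balanced.
\<close>

definition non_nbrs :: "'a pair_pre_digraph \<Rightarrow> 'a set \<Rightarrow> 'a \<Rightarrow> 'a set" where
  "non_nbrs G A w = {v \<in> A. (v, w) \<notin> parcs G}"

definition hitting :: "'a pair_pre_digraph \<Rightarrow> 'a set \<Rightarrow> 'a set \<Rightarrow> 'a set set" where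
  "hitting G A B = {S. S \<subseteq> A \<and> (\<forall>w \<in> B. S \<inter> non_nbrs G A w \<noteq> {})}"

definition straddling :: "'a set \<Rightarrow> 'a set \<Rightarrow> 'a set set" where
  "straddling A B = {S. S \<subseteq> A \<union> B \<and> S \<inter> A \<noteq> {} \<and> S \<inter> B \<noteq> {}}"

definition undominating :: "'a pair_pre_digraph \<Rightarrow> 'a set \<Rightarrow> 'a set \<Rightarrow> 'a set set" where
  "undominating G A B = {S \<in> straddling A B. \<not> dominating G S}"

definition undominating_sides :: "'a pair_pre_digraph \<Rightarrow> 'a set \<Rightarrow> 'a set \<Rightarrow> 'a set set" where
  "undominating_sides G A B = {S \<in> {A, B}. \<not> dominating G S}"

text \<open>
  For \<open>w\<close> in \<open>B\<close> these are straddling sets lost by \<open>G\<close>: a vertex of \<open>A\<close> that is neither in \<open>X\<close> nor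
  adjacent to \<open>w\<close> has no neighbour in \<open>insert w X\<close>.
\<close>

definition pointed :: "'a pair_pre_digraph \<Rightarrow> 'a set \<Rightarrow> 'a \<Rightarrow> 'a set set" where
  "pointed G A w = insert w ` {X. X \<subseteq> A \<and> X \<noteq> {} \<and> \<not> non_nbrs G A w \<subseteq> X}"


section \<open>Arithmetic and counting\<close>

lemma pred_power_mult:
  "(2 ^ a - 1) * (2 ^ b - 1) + (2 ^ a + 2 ^ b) = 2 ^ (a + b) + (1 :: nat)"
proof -
  obtain p :: nat where "2 ^ a = Suc p"
    using not0_implies_Suc[of "2 ^ a"] by auto
  moreover obtain q :: nat where "2 ^ b = Suc q"
    using not0_implies_Suc[of "2 ^ b"] by auto
  ultimately show ?thesis
    by (simp add: power_add)
qed

lemma balanced_power_sum_le: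
  fixes a b :: nat
  assumes "a \<le> b"
  shows "2 ^ ((a + b) div 2) + 2 ^ ((a + b + 1) div 2) \<le> 2 ^ a + (2 :: nat) ^ b"
proof -
  define d c where "d = (a + b) div 2 - a" and "c = (a + b + 1) div 2"
  have k: "(a + b) div 2 = a + d" and b: "b = c + d" and ac: "a \<le> c"
    using assms unfolding d_def c_def by auto
  obtain r :: nat where r: "2 ^ d = Suc r"
    using not0_implies_Suc[of "2 ^ d"] by auto
  have "(2 :: nat) ^ a * r \<le> 2 ^ c * r"
    using ac by (intro mult_right_mono power_increasing) auto
  then have "2 ^ (a + d) + 2 ^ c \<le> 2 ^ a + (2 :: nat) ^ (c + d)"
    by (simp add: power_add r)
  then show ?thesis
    unfolding k c_def[symmetric] b[symmetric] .
qed

lemma pred_power_mult_le_balanced: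
  fixes a b :: nat
  shows "(2 ^ a - 1) * (2 ^ b - 1)
    \<le> (2 ^ ((a + b) div 2) - 1) * (2 ^ ((a + b + 1) div 2) - (1 :: nat))"
proof -
  have sum: "2 ^ ((a + b) div 2) + 2 ^ ((a + b + 1) div 2) \<le> 2 ^ a + (2 :: nat) ^ b"
    using balanced_power_sum_le[of a b] balanced_power_sum_le[of b a]
    by (cases "a \<le> b") (simp_all add: add.commute)
  have "(a + b) div 2 + (a + b + 1) div 2 = a + b"
    by auto
  then show ?thesis
    using sum pred_power_mult[of a b] pred_power_mult[of "(a + b) div 2" "(a + b + 1) div 2"]
    by simp
qed

lemma straddling_commute: "straddling B A = straddling A B"
  by (auto simp: straddling_def)

lemma card_straddling:
  assumes "finite A" and "finite B" and "A \<inter> B = {}"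
  shows "card (straddling A B) = (2 ^ card A - 1) * (2 ^ card B - 1)"
proof -
  have "bij_betw (\<lambda>(X, Y). X \<union> Y) ((Pow A - {{}}) \<times> (Pow B - {{}})) (straddling A B)"
    by (rule bij_betw_byWitness[where f' = "\<lambda>S. (S \<inter> A, S \<inter> B)"])
      (use assms(3) in \<open>auto simp: straddling_def\<close>)
  then have "card (straddling A B) = card ((Pow A - {{}}) \<times> (Pow B - {{}}))"
    by (simp add: bij_betw_same_card)
  also have "\<dots> = (2 ^ card A - 1) * (2 ^ card B - 1)"
    using assms by (simp add: card_cartesian_product card_Diff_singleton card_Pow)
  finally show ?thesis .
qed


section \<open>Domination in a bipartite graph and in its complement\<close>

locale bipartite_graph =
  fixes G :: "'a pair_pre_digraph" and A B :: "'a set"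
  assumes pair_graph: "pair_graph G" and bipartition: "nonempty_bipartition G A B"
begin

lemma swap: "bipartite_graph G B A"
  using pair_graph bipartition
  by (intro bipartite_graph.intro) (auto simp: nonempty_bipartition_def)

lemma sides: "A \<noteq> {}" "B \<noteq> {}" "A \<inter> B = {}" "pverts G = A \<union> B" "A \<noteq> B"
  using bipartition by (auto simp: nonempty_bipartition_def)

lemma no_inner_edge:
  "u \<in> A \<Longrightarrow> v \<in> A \<Longrightarrow> (u, v) \<notin> parcs G" "u \<in> B \<Longrightarrow> v \<in> B \<Longrightarrow> (u, v) \<notin> parcs G"
  using bipartition by (auto simp: nonempty_bipartition_def)

lemma finite_sides: "finite A" "finite B"
proof -
  interpret pair_graph G by (rule pair_graph)
  have "finite (A \<union> B)"
    using pair_finite_verts sides by simp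
  then show "finite A" "finite B"
    by auto
qed

lemma edge_commute: "(u, v) \<in> parcs G \<longleftrightarrow> (v, u) \<in> parcs G"
proof -
  interpret pair_graph G by (rule pair_graph)
  show ?thesis
    using arcs_symmetric by auto
qed

lemma non_nbrs_commute:
  "v \<in> A \<Longrightarrow> w \<in> B \<Longrightarrow> v \<in> non_nbrs G A w \<longleftrightarrow> w \<in> non_nbrs G B v"
  using edge_commute by (auto simp: non_nbrs_def)

lemma finite_straddling: "finite (straddling A B)"
  by (rule finite_subset[of _ "Pow (A \<union> B)"])
    (use finite_sides in \<open>auto simp: straddling_def\<close>)

lemma finite_undominating: "finite (undominating G A B)"
  using finite_straddling by (simp add: undominating_def)

lemma finite_hitting: "finite (hitting G A B)"
  by (rule finite_subset[of _ "Pow A"]) (use finite_sides in \<open>auto simp: hitting_def\<close>)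

text \<open>A set inside \<open>A\<close> cannot dominate another vertex of \<open>A\<close>, as \<open>A\<close> is independent.\<close>

lemma dominating_cases:
  assumes "dominating G S"
  shows "S \<in> straddling A B \<or> S = A \<or> S = B"
proof (rule ccontr)
  assume no: "\<not> ?thesis"
  have S: "S \<subseteq> A \<union> B" and dom: "\<And>v. v \<in> A \<union> B \<Longrightarrow> v \<in> S \<or> (\<exists>u \<in> S. (v, u) \<in> parcs G)"
    using assms sides by (auto simp: dominating_def)
  have "S \<subseteq> A \<or> S \<subseteq> B"
    using no S by (auto simp: straddling_def)
  then show False
  proof
    assume "S \<subseteq> A"
    then have "A \<subseteq> S"
      using dom no_inner_edge by blast
    then show False
      using \<open>S \<subseteq> A\<close> no by auto
  next
    assume "S \<subseteq> B"
    then have "B \<subseteq> S"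
      using dom no_inner_edge by blast
    then show False
      using \<open>S \<subseteq> B\<close> no by auto
  qed
qed

lemma hitting_if_dominating_complement:
  assumes "dominating (complement G) S" and "S \<subseteq> A"
  shows "S \<in> hitting G A B"
proof -
  have "S \<inter> non_nbrs G A w \<noteq> {}" if "w \<in> B" for w
  proof -
    have "w \<in> pverts (complement G)" "w \<notin> S"
      using that assms(2) sides by (auto simp: complement_def)
    then obtain u where "u \<in> S" "(w, u) \<in> parcs (complement G)"
      using assms(1) by (auto simp: dominating_def)
    then have "u \<in> S \<inter> non_nbrs G A w"
      using assms(2) edge_commute by (auto simp: non_nbrs_def complement_def)
    then show ?thesis
      by blast
  qed
  then show ?thesis
    using assms(2) by (simp add: hitting_def)
qed

text \<open>
  One vertex left out by \<open>X \<union> Y\<close> that has no neighbour in the part on the other side suffices.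
\<close>

lemma undominatingI:
  assumes "X \<subseteq> A" and "X \<noteq> {}" and "Y \<subseteq> B" and "Y \<noteq> {}"
    and v: "v \<in> A" "v \<notin> X" "Y \<subseteq> non_nbrs G B v"
  shows "X \<union> Y \<in> undominating G A B"
proof -
  have "v \<notin> Y"
    using assms(3) v(1) sides by auto
  moreover have "\<forall>u \<in> X \<union> Y. (v, u) \<notin> parcs G"
    using assms(1) v no_inner_edge edge_commute by (auto simp: non_nbrs_def)
  ultimately have "\<not> dominating G (X \<union> Y)"
    using v sides by (auto simp: dominating_def)
  then show ?thesis
    using assms sides by (auto simp: undominating_def straddling_def)
qed

lemma pointed_subset_undominating:
  assumes "w \<in> B"
  shows "pointed G A w \<subseteq> undominating G A B"
proof
  fix S
  assume "S \<in> pointed G A w"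
  then obtain X v where X: "S = insert w X" "X \<subseteq> A" "X \<noteq> {}" and v: "v \<in> non_nbrs G A w" "v \<notin> X"
    by (auto simp: pointed_def)
  have "v \<in> A"
    using v by (simp add: non_nbrs_def)
  then have "X \<union> {w} \<in> undominating G A B"
    using X v assms non_nbrs_commute by (intro undominatingI[of _ _ v]) auto
  then show "S \<in> undominating G A B"
    using X by simp
qed


section \<open>Comparing gains in the complement with losses in the graph\<close>

text \<open>
  Taking complements in \<open>A\<close> turns the sets that meet the non-neighbours of \<open>w\<close> into those that do not
  contain all of them. Adding \<open>w\<close> to such a set gives a pointed set unless it is empty, whence the
  additional \<open>1\<close>.
\<close>

lemma card_meeting_le_pointed:
  assumes "w \<in> B"
  shows "card {S. S \<subseteq> A \<and> S \<inter> non_nbrs G A w \<noteq> {}} \<le> card (pointed G A w) + 1"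
proof -
  define K where "K = {X. X \<subseteq> A \<and> X \<noteq> {} \<and> \<not> non_nbrs G A w \<subseteq> X}"
  have fin: "finite K"
    by (rule finite_subset[of _ "Pow A"]) (use finite_sides in \<open>auto simp: K_def\<close>)
  have "inj_on (insert w) K"
    by (rule inj_onI) (use assms sides in \<open>auto simp: K_def insert_ident\<close>)
  then have card: "card (pointed G A w) = card K"
    by (simp add: pointed_def K_def card_image)
  have "card {S. S \<subseteq> A \<and> S \<inter> non_nbrs G A w \<noteq> {}} \<le> card (insert {} K)"
  proof (rule card_inj_on_le[of "\<lambda>S. A - S"])
    show "inj_on (\<lambda>S. A - S) {S. S \<subseteq> A \<and> S \<inter> non_nbrs G A w \<noteq> {}}"
      by (rule inj_onI) auto
    show "(\<lambda>S. A - S) ` {S. S \<subseteq> A \<and> S \<inter> non_nbrs G A w \<noteq> {}} \<subseteq> insert {} K"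
      by (auto simp: K_def)
    show "finite (insert {} K)"
      using fin by simp
  qed
  also have "\<dots> \<le> card K + 1"
    using fin by (simp add: card_insert_if)
  finally show ?thesis
    using card by simp
qed

lemma hitting_subset_meeting:
  "w \<in> B \<Longrightarrow> hitting G A B \<subseteq> {S. S \<subseteq> A \<and> S \<inter> non_nbrs G A w \<noteq> {}}"
  by (auto simp: hitting_def)

lemma finite_meeting: "finite {S. S \<subseteq> A \<and> S \<inter> non_nbrs G A w \<noteq> {}}"
  by (rule finite_subset[of _ "Pow A"]) (use finite_sides in auto)

lemma card_hitting_le_pointed_Suc:
  assumes "w \<in> B"
  shows "card (hitting G A B) \<le> card (pointed G A w) + 1"
  using card_mono[OF finite_meeting hitting_subset_meeting[OF assms]]
    card_meeting_le_pointed[OF assms] by simp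

text \<open>
  A vertex \<open>v\<close> that is a non-neighbour of \<open>w\<close> but not of \<open>w'\<close> makes \<open>{v}\<close> a set that meets the
  non-neighbours of \<open>w\<close> without being hitting. This recovers the missing set.
\<close>

lemma card_hitting_le_pointed:
  assumes "w \<in> B" and "w' \<in> B" and "\<not> non_nbrs G A w \<subseteq> non_nbrs G A w'"
  shows "card (hitting G A B) \<le> card (pointed G A w)"
proof -
  obtain v where v: "v \<in> non_nbrs G A w" "v \<notin> non_nbrs G A w'"
    using assms(3) by auto
  then have "v \<in> A"
    by (simp add: non_nbrs_def)
  then have "{v} \<notin> hitting G A B" and "{v} \<in> {S. S \<subseteq> A \<and> S \<inter> non_nbrs G A w \<noteq> {}}"
    using v assms(2) by (auto simp: hitting_def)
  then have "hitting G A B \<subset> {S. S \<subseteq> A \<and> S \<inter> non_nbrs G A w \<noteq> {}}"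
    using hitting_subset_meeting[OF assms(1)] by blast
  then have "card (hitting G A B) < card {S. S \<subseteq> A \<and> S \<inter> non_nbrs G A w \<noteq> {}}"
    by (rule psubset_card_mono[OF finite_meeting])
  then show ?thesis
    using card_meeting_le_pointed[OF assms(1)] by simp
qed

text \<open>
  An edgeless graph is the extreme case: nothing straddling except \<open>A \<union> B\<close> dominates it, and \<open>A\<close>, \<open>B\<close>
  do not either. The claim becomes \<open>(2\<^sup>a - 2) (2\<^sup>b - 2) \<ge> 0\<close>.
\<close>

lemma card_hitting_le_undominating_edgeless:
  assumes "parcs G = {}"
  shows "card (hitting G A B) + card (hitting G B A)
    \<le> card (undominating G A B) + card (undominating_sides G A B)"
proof -
  have dom: "dominating G S \<longleftrightarrow> S = A \<union> B" for S
    using assms sides by (auto simp: dominating_def)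
  have "A \<union> B \<in> straddling A B"
    using sides by (auto simp: straddling_def)
  moreover have "undominating G A B = straddling A B - {A \<union> B}"
    by (auto simp: undominating_def dom)
  ultimately have N: "card (undominating G A B) = (2 ^ card A - 1) * (2 ^ card B - 1) - 1"
    using card_straddling[OF finite_sides sides(3)] by (simp add: card_Diff_singleton)
  have "undominating_sides G A B = {A, B}"
    using sides by (auto simp: undominating_sides_def dom)
  then have P: "card (undominating_sides G A B) = 2"
    using sides by simp
  have HA: "card (hitting G A B) \<le> 2 ^ card A - 1"
  proof -
    have "hitting G A B \<subseteq> Pow A - {{}}"
      using sides by (auto simp: hitting_def)
    then have "card (hitting G A B) \<le> card (Pow A - {{}})"
      using finite_sides by (intro card_mono) auto
    then show ?thesis
      using finite_sides by (simp add: card_Pow)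
  qed
  have HB: "card (hitting G B A) \<le> 2 ^ card B - 1"
  proof -
    have "hitting G B A \<subseteq> Pow B - {{}}"
      using sides by (auto simp: hitting_def)
    then have "card (hitting G B A) \<le> card (Pow B - {{}})"
      using finite_sides by (intro card_mono) auto
    then show ?thesis
      using finite_sides by (simp add: card_Pow)
  qed
  have "1 \<le> card A" "1 \<le> card B"
    using sides finite_sides by (simp_all add: Suc_leI card_gt_0_iff)
  then have "(2 :: nat) ^ 1 \<le> 2 ^ card A" "(2 :: nat) ^ 1 \<le> 2 ^ card B"
    by (intro power_increasing; simp)+
  then obtain p q :: nat where "2 ^ card A = 2 + p" "2 ^ card B = 2 + q"
    unfolding power_one_right using le_Suc_ex by blast
  then show ?thesis
    using N P HA HB by simp
qed

text \<open>
  If every vertex of \<open>B\<close> has the same set \<open>Q\<close> of non-neighbours, the vertices of \<open>Q\<close> are isolated and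
  those of \<open>A - Q\<close> are joined to all of \<open>B\<close>. Unless \<open>Q = A\<close>, no subset of \<open>B\<close> is hitting. Then either
  \<open>Q\<close> is empty and no subset of \<open>A\<close> is hitting either, or an isolated vertex keeps \<open>B\<close> from dominating
  \<open>G\<close>, which makes up for the \<open>1\<close> in \<open>card_hitting_le_pointed_Suc\<close>.
\<close>

lemma card_hitting_le_undominating_uniform:
  assumes Q: "\<And>w. w \<in> B \<Longrightarrow> non_nbrs G A w = Q"
  shows "card (hitting G A B) + card (hitting G B A)
    \<le> card (undominating G A B) + card (undominating_sides G A B)"
proof -
  obtain w where w: "w \<in> B"
    using sides by auto
  have QA: "Q \<subseteq> A"
    using Q[OF w] by (auto simp: non_nbrs_def)
  interpret pair_graph G by (rule pair_graph)
  show ?thesis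
  proof (cases "Q = A")
    case True
    have "(u, v) \<notin> parcs G" for u v
    proof
      assume uv: "(u, v) \<in> parcs G"
      then have "u \<in> A \<union> B" "v \<in> A \<union> B"
        using sides in_arcsD1 in_arcsD2 by auto
      then have "u \<in> A \<and> v \<in> B \<or> u \<in> B \<and> v \<in> A"
        using uv no_inner_edge by auto
      moreover have "x \<in> A \<Longrightarrow> y \<in> B \<Longrightarrow> (x, y) \<notin> parcs G" for x y
        using Q[of y] True by (auto simp: non_nbrs_def)
      ultimately show False
        using uv edge_commute by blast
    qed
    then have "parcs G = {}"
      by auto
    then show ?thesis
      by (rule card_hitting_le_undominating_edgeless)
  next
    case False
    then obtain v where v: "v \<in> A" "v \<notin> Q"
      using QA by auto
    then have "non_nbrs G B v = {}"
      using Q non_nbrs_commute by (auto simp: non_nbrs_def)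
    then have HB: "hitting G B A = {}"
      using v by (auto simp: hitting_def)
    show ?thesis
    proof (cases "Q = {}")
      case True
      then have "hitting G A B = {}"
        using Q w by (auto simp: hitting_def)
      then show ?thesis
        using HB by simp
    next
      case False
      then obtain u where u: "u \<in> Q"
        by auto
      then have "\<forall>y \<in> B. (u, y) \<notin> parcs G"
        using Q by (auto simp: non_nbrs_def)
      moreover have "u \<in> A" "u \<notin> B"
        using u QA sides by auto
      ultimately have "\<not> dominating G B"
        using sides by (auto simp: dominating_def)
      then have "B \<in> undominating_sides G A B"
        by (simp add: undominating_sides_def)
      then have P: "1 \<le> card (undominating_sides G A B)"
        by (auto simp: Suc_le_eq card_gt_0_iff undominating_sides_def)
      have "card (pointed G A w) \<le> card (undominating G A B)"
        by (rule card_mono[OF finite_undominating pointed_subset_undominating[OF w]])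
      then show ?thesis
        using card_hitting_le_pointed_Suc[OF w] HB P by simp
    qed
  qed
qed

lemma undominating_commute: "undominating G B A = undominating G A B"
  by (simp add: undominating_def straddling_commute)

lemma undominating_sides_commute: "undominating_sides G B A = undominating_sides G A B"
  by (auto simp: undominating_sides_def)

lemma pointed_inter_subset:
  assumes "v \<in> A" and "w \<in> B"
  shows "pointed G A w \<inter> pointed G B v \<subseteq> {{v, w}}"
proof
  fix S
  assume "S \<in> pointed G A w \<inter> pointed G B v"
  then obtain X Y where "S = insert w X" "X \<subseteq> A" "S = insert v Y" "Y \<subseteq> B"
    by (auto simp: pointed_def)
  then show "S \<in> {{v, w}}"
    using assms sides by blast
qed

text \<open>
  Both one-sided comparisons hold without the additional \<open>1\<close> here, so it only remains to replace the
  set \<open>{v, w}\<close> in case both of them use it.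
\<close>

lemma card_hitting_le_undominating_diverse:
  assumes w: "w \<in> B" "w' \<in> B" "\<not> non_nbrs G A w \<subseteq> non_nbrs G A w'"
    and v: "v \<in> A" "v' \<in> A" "\<not> non_nbrs G B v \<subseteq> non_nbrs G B v'"
  shows "card (hitting G A B) + card (hitting G B A) \<le> card (undominating G A B)"
proof -
  interpret swapped: bipartite_graph G B A by (rule swap)
  let ?N = "undominating G A B" and ?N1 = "pointed G A w" and ?N2 = "pointed G B v"
  have sub: "?N1 \<subseteq> ?N" "?N2 \<subseteq> ?N"
    using pointed_subset_undominating[OF w(1)] swapped.pointed_subset_undominating[OF v(1)]
    by (simp_all add: undominating_commute)
  have fin: "finite ?N1" "finite ?N2"
    using sub finite_undominating finite_subset by auto
  have le: "card (hitting G A B) + card (hitting G B A) \<le> card ?N1 + card ?N2"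
    using card_hitting_le_pointed[OF w] swapped.card_hitting_le_pointed[OF v] by simp
  have sum: "card ?N1 + card ?N2 = card (?N1 \<union> ?N2) + card (?N1 \<inter> ?N2)"
    by (rule card_Un_Int[OF fin])
  show ?thesis
  proof (cases "{v, w} \<in> ?N1")
    case False
    then have "?N1 \<inter> ?N2 = {}"
      using pointed_inter_subset[OF v(1) w(1)] by blast
    then have "card ?N1 + card ?N2 \<le> card ?N"
      using sum sub finite_undominating card_mono[of ?N "?N1 \<union> ?N2"] by simp
    then show ?thesis
      using le by simp
  next
    case True
    then obtain X where X: "{v, w} = insert w X" "X \<subseteq> A" "\<not> non_nbrs G A w \<subseteq> X"
      by (auto simp: pointed_def)
    have "w \<notin> X" and "w \<noteq> v"
      using X(2) v(1) w(1) sides by auto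
    then have "X = {v}"
      using X(1) by (metis insertCI insert_commute insert_ident singletonD)
    then obtain u where u: "u \<in> non_nbrs G A w" "u \<noteq> v"
      using X by auto
    then have uA: "u \<in> A"
      by (simp add: non_nbrs_def)
    have ww: "w' \<noteq> w"
      using w by auto
    \<comment> \<open>The set \<open>{u, w'}\<close> does not dominate \<open>w\<close>, and it lies in neither family because it contains
      neither \<open>w\<close> nor \<open>v\<close>.\<close>
    have "{w'} \<union> {u} \<in> undominating G B A"
      by (rule swapped.undominatingI[of _ _ w]) (use u uA w ww in auto)
    then have extra: "{u, w'} \<in> ?N"
      by (simp add: undominating_commute insert_commute)
    have notin: "{u, w'} \<notin> ?N1 \<union> ?N2"
    proof -
      have "w \<notin> {u, w'}" "v \<notin> {u, w'}"
        using ww u uA w v sides by auto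
      then show ?thesis
        by (auto simp: pointed_def)
    qed
    have "card (?N1 \<inter> ?N2) \<le> card {{v, w}}"
      by (rule card_mono[OF _ pointed_inter_subset[OF v(1) w(1)]]) simp
    then have "card ?N1 + card ?N2 \<le> card (insert {u, w'} (?N1 \<union> ?N2))"
      using sum notin fin by simp
    also have "\<dots> \<le> card ?N"
      by (rule card_mono[OF finite_undominating]) (use sub extra in auto)
    finally show ?thesis
      using le by simp
  qed
qed

lemma card_hitting_le_undominating:
  "card (hitting G A B) + card (hitting G B A)
    \<le> card (undominating G A B) + card (undominating_sides G A B)"
proof -
  interpret swapped: bipartite_graph G B A by (rule swap)
  consider (B) "\<And>w w'. w \<in> B \<Longrightarrow> w' \<in> B \<Longrightarrow> non_nbrs G A w \<subseteq> non_nbrs G A w'"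
    | (A) "\<And>v v'. v \<in> A \<Longrightarrow> v' \<in> A \<Longrightarrow> non_nbrs G B v \<subseteq> non_nbrs G B v'"
    | (neither) w w' v v' where "w \<in> B" "w' \<in> B" "\<not> non_nbrs G A w \<subseteq> non_nbrs G A w'"
        "v \<in> A" "v' \<in> A" "\<not> non_nbrs G B v \<subseteq> non_nbrs G B v'"
    by blast
  then show ?thesis
  proof cases
    case B
    obtain w where "w \<in> B"
      using sides by auto
    then have "non_nbrs G A w' = non_nbrs G A w" if "w' \<in> B" for w'
      using B that by (simp add: subset_antisym)
    then show ?thesis
      by (rule card_hitting_le_undominating_uniform)
  next
    case A
    obtain v where "v \<in> A"
      using sides by auto
    then have "non_nbrs G B v' = non_nbrs G B v" if "v' \<in> A" for v'
      using A that by (simp add: subset_antisym)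
    then have "card (hitting G B A) + card (hitting G A B)
        \<le> card (undominating G B A) + card (undominating_sides G B A)"
      by (rule swapped.card_hitting_le_undominating_uniform)
    then show ?thesis
      by (simp add: undominating_commute undominating_sides_commute)
  next
    case neither
    then show ?thesis
      using card_hitting_le_undominating_diverse by (meson trans_le_add1)
  qed
qed

lemma num_dominating_add_undominating_le:
  "num_dominating G + card (undominating G A B) + card (undominating_sides G A B)
    \<le> card (straddling A B) + 2"
proof -
  let ?D = "straddling A B - undominating G A B" and ?E = "{A, B} - undominating_sides G A B"
  have N: "undominating G A B \<subseteq> straddling A B"
    by (auto simp: undominating_def)
  have P: "undominating_sides G A B \<subseteq> {A, B}"
    by (auto simp: undominating_sides_def)
  have "{S. dominating G S} \<subseteq> ?D \<union> ?E"
    using dominating_cases by (auto simp: undominating_def undominating_sides_def)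
  then have "num_dominating G \<le> card (?D \<union> ?E)"
    unfolding num_dominating_def using finite_straddling by (intro card_mono) auto
  also have "\<dots> \<le> card ?D + card ?E"
    by (rule card_Un_le)
  finally have "num_dominating G \<le> card ?D + card ?E" .
  moreover have "card ?D + card (undominating G A B) = card (straddling A B)"
    using card_Diff_subset[OF finite_undominating N] card_mono[OF finite_straddling N] by simp
  moreover have "card ?E + card (undominating_sides G A B) = card {A, B}"
    using card_Diff_subset[OF finite_subset[OF P] P] card_mono[OF _ P] by simp
  moreover have "card {A, B} = 2"
    using sides by simp
  ultimately show ?thesis
    by simp
qed

lemma num_dominating_complement_le:
  "num_dominating (complement G)
    \<le> card (straddling A B) + (card (hitting G A B) + card (hitting G B A))"
proof -
  interpret swapped: bipartite_graph G B A by (rule swap)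
  have "{S. dominating (complement G) S} \<subseteq> straddling A B \<union> (hitting G A B \<union> hitting G B A)"
  proof
    fix S
    assume "S \<in> {S. dominating (complement G) S}"
    then have dom: "dominating (complement G) S"
      by simp
    then have "S \<subseteq> A \<union> B"
      using sides by (simp add: dominating_def complement_def)
    then have "S \<in> straddling A B \<or> S \<subseteq> A \<or> S \<subseteq> B"
      by (auto simp: straddling_def)
    then show "S \<in> straddling A B \<union> (hitting G A B \<union> hitting G B A)"
      using hitting_if_dominating_complement[OF dom]
        swapped.hitting_if_dominating_complement[OF dom] by blast
  qed
  then have "num_dominating (complement G)
      \<le> card (straddling A B \<union> (hitting G A B \<union> hitting G B A))"
    unfolding num_dominating_def
    using finite_straddling finite_hitting swapped.finite_hitting by (intro card_mono) auto
  also have "\<dots> \<le> card (straddling A B) + (card (hitting G A B) + card (hitting G B A))"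
    by (intro order.trans[OF card_Un_le] add_left_mono card_Un_le)
  finally show ?thesis .
qed

end


section \<open>The bound\<close>

theorem corollary2p2:
  fixes G :: "'a pair_pre_digraph" and A B :: "'a set" and n :: nat
  assumes "pair_graph G"
    and "nonempty_bipartition G A B"
    and "n = card A + card B"
  shows "num_dominating G + num_dominating (complement G)
    \<le> 2 * (2 ^ (n div 2) - 1) * (2 ^ ((n + 1) div 2) - 1) + 2"
proof -
  interpret bipartite_graph G A B
    using assms(1,2) by (rule bipartite_graph.intro)
  have "num_dominating G + num_dominating (complement G) \<le> 2 * card (straddling A B) + 2"
    using num_dominating_add_undominating_le num_dominating_complement_le
      card_hitting_le_undominating by simp
  also have "card (straddling A B) = (2 ^ card A - 1) * (2 ^ card B - 1)"
    using card_straddling finite_sides sides by blast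
  also have "\<dots> \<le> (2 ^ (n div 2) - 1) * (2 ^ ((n + 1) div 2) - 1)"
    using pred_power_mult_le_balanced[of "card A" "card B"] assms(3) by simp
  finally show ?thesis
    by (simp add: mult.assoc)
qed

end
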